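(* Let $n\ge1$ and $a,b>0$. On $(S^{2n+1}=\mathrm{SU}(n+1)/\mathrm{SU}(n),g_{a,b})$ the invariant spinors $\psi_+=1$ and $\psi_-=y_1\wedge\dots\wedge y_n$ are generalized Killing spinors: $\nabla^{g_{a,b}}_X\psi_\pm=A_\pm(X)\cdot\psi_\pm$ for all $X$, with the endomorphisms $$A_+=\lambda_1\,\mathrm{Id}|_{\mathfrak m_1}+\lambda_2\,\mathrm{Id}|_{\mathfrak m_2},\qquad A_-=(-1)^{n+1}A_+,$$ where $\lambda_1=\frac{(2b-a)\sqrt{n(n+1)}}{4b\sqrt a}$ and $\lambda_2=\frac{\sqrt{a(n+1)}}{4b\sqrt n}$.
   Context: $E_{i,j}$ is the $(n+1)\times(n+1)$ matrix with $-1$ in position $(i,j)$, $+1$ in $(j,i)$; $F_{i,j}$ ($i\ne j$) has $1$ in $(i,j)$ and $(j,i)$; $F_{i,i}$ has $1$ in $(i,i)$; other entries zero. $B_0(X_1,X_2)=-\mathrm{Re}\,\mathrm{tr}(X_1X_2)$. $\mathrm{SU}(n)\subset\mathrm{SU}(n+1)$ is the lower right block, $\mathfrak h=\mathfrak{su}(n)$, $\mathfrak m=\mathfrak h^{\perp_{B_0}}=\mathfrak m_1\oplus\mathfrak m_2\cong T_{eH}S^{2n+1}$, and $g_{a,b}=aB_0|_{\mathfrak m_1}+bB_0|_{\mathfrak m_2}$, with $g_{a,b}$-orthonormal basis $e_1=\frac1{\sqrt{an(n+1)}}(-niF_{1,1}+\sum_{l=2}^{n+1}iF_{l,l})$ of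 $\mathfrak m_1$ and $e_{2p}=\frac1{\sqrt{2b}}E_{1,p+1}$, $e_{2p+1}=\frac{i}{\sqrt{2b}}F_{1,p+1}$ ($p=1,\dots,n$) of $\mathfrak m_2$. Spin module: $x_j=\frac1{\sqrt2}(e_{2j}-ie_{2j+1})$, $y_j=\frac1{\sqrt2}(e_{2j}+ie_{2j+1})$, $\Sigma=\Lambda^\bullet\mathrm{span}_{\mathbb C}\{y_1,\dots,y_n\}$, $e_{2j}\cdot\eta=i(x_j\lrcorner\eta+y_j\wedge\eta)$, $e_{2j+1}\cdot\eta=y_j\wedge\eta-x_j\lrcorner\eta$, $e_1\cdot\eta=i\eta$ (even degree), $-i\eta$ (odd degree), where $x_j\lrcorner$ is the antiderivation with $x_j\lrcorner y_k=\delta_{jk}$. The spin lift of $e_i\wedge e_j$ ($e_i\mapsto e_j$, $e_j\mapsto-e_i$) is $\frac12e_i\cdot e_j$. Invariant spinors are elements of $\Sigma$ annihilated by the spin lifts of $\mathrm{ad}(h)|_{\mathfrak m}$, $h\in\mathfrak h$ (constant equivariant maps $G\to\Sigma$). For an invariant spinor, at the origin $\nabla^g_X\psi=\widetilde{\Lambda^g(X)}\cdot\psi$ ($X\in\mathfrak m$), where $\Lambda^g(X)Y=\frac12[X,Y]_{\mathfrak m}+U(X,Y)$, $2g(U(X,Y),Z)=g([Z,X]_{\mathfrak m},Y)+g(X,[Z,Y]_{\mathfrak m})$ and tilde is the spin lift. A generalized Killing spinor is one satisfying $\nabla^g_X\psi=A(X)\cdot\psi$ with $A$ symmetric. *)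

theory Defs
  imports "HOL-Analysis.Analysis"
begin

text \<open>
  A finite linearly ordered type \<open>'n\<close> plays the role of \<open>{1, \<dots>, n}\<close>, so \<open>n = CARD('n) \<ge> 1\<close>.
  The rows and columns \<open>1, \<dots>, n + 1\<close> are indexed by \<open>'n option\<close>: \<open>None\<close> is the index \<open>1\<close> and
  \<open>Some p\<close> is the index \<open>p + 1\<close>.
\<close>

type_synonym 'n cmat = "complex ^ 'n option ^ 'n option"


subsection \<open>The Lie algebras and the reductive complement\<close>

definition cscale :: "complex \<Rightarrow> 'n::finite cmat \<Rightarrow> 'n cmat"
  where "cscale c X = (\<chi> r s. c * X $ r $ s)"

definition E_mat :: "'n option \<Rightarrow> 'n option \<Rightarrow> 'n::finite cmat"
  where "E_mat i j = (\<chi> r s. if r = i \<and> s = j then -1 else if r = j \<and> s = i then 1 else 0)"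

definition F_mat :: "'n option \<Rightarrow> 'n option \<Rightarrow> 'n::finite cmat"
  where "F_mat i j = (\<chi> r s. if r = i \<and> s = j \<or> r = j \<and> s = i then 1 else 0)"

definition lie_bracket :: "'n::finite cmat \<Rightarrow> 'n cmat \<Rightarrow> 'n cmat"
  where "lie_bracket X Y = X ** Y - Y ** X"

definition B0 :: "'n::finite cmat \<Rightarrow> 'n cmat \<Rightarrow> real"
  where "B0 X Y = - Re (trace (X ** Y))"

definition su_alg :: "'n::finite cmat set"
  where "su_alg = {X. (\<forall>r s. cnj (X $ s $ r) = - X $ r $ s) \<and> trace X = 0}"

text \<open>The isotropy algebra \<open>su(n)\<close>, embedded as the lower right block.\<close>

definition h_alg :: "'n::finite cmat set"
  where "h_alg = {X \<in> su_alg. \<forall>r. X $ None $ r = 0 \<and> X $ r $ None = 0}"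

definition m_space :: "'n::finite cmat set"
  where "m_space = {X \<in> su_alg. \<forall>H\<in>h_alg. B0 X H = 0}"

definition e1_direction :: "'n::finite cmat"
  where "e1_direction = - real CARD('n) *\<^sub>R cscale \<i> (F_mat None None)
           + (\<Sum>l\<in>UNIV. cscale \<i> (F_mat (Some l) (Some l)))"

definition m1_space :: "'n::finite cmat set"
  where "m1_space = span {e1_direction}"

definition m2_space :: "'n::finite cmat set"
  where "m2_space = span (range (\<lambda>p. E_mat None (Some p)) \<union>
                          range (\<lambda>p. cscale \<i> (F_mat None (Some p))))"

text \<open>
  The \<open>B0\<close>-orthogonal projection onto a real subspace \<open>W\<close> of \<open>su(n+1)\<close>, applied to elements of
  \<open>su(n+1)\<close> only; on \<open>su(n+1)\<close> the form \<open>B0\<close> is positive definite. As \<open>m\<close> is the orthogonal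
  complement of \<open>h\<close>, the case \<open>W = m\<close> is the projection onto \<open>m\<close> along \<open>h\<close>.
\<close>

definition proj :: "'n::finite cmat set \<Rightarrow> 'n cmat \<Rightarrow> 'n cmat"
  where "proj W X = (THE Y. Y \<in> W \<and> (\<forall>Z\<in>W. B0 (X - Y) Z = 0))"

definition g_metric :: "real \<Rightarrow> real \<Rightarrow> 'n::finite cmat \<Rightarrow> 'n cmat \<Rightarrow> real"
  where "g_metric a b X Y = a * B0 (proj m1_space X) (proj m1_space Y)
           + b * B0 (proj m2_space X) (proj m2_space Y)"

text \<open>
  The basis of \<open>m\<close> is indexed by \<open>('n + 'n) option\<close>: \<open>None\<close> stands for \<open>e\<^sub>1\<close>, \<open>Some (Inl p)\<close> for
  \<open>e\<close> with index \<open>2p\<close>, and \<open>Some (Inr p)\<close> for \<open>e\<close> with index \<open>2p + 1\<close>.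
\<close>

definition e_basis :: "real \<Rightarrow> real \<Rightarrow> ('n + 'n) option \<Rightarrow> 'n::finite cmat"
  where "e_basis a b i = (case i of
      None \<Rightarrow> (1 / sqrt (a * real CARD('n) * (real CARD('n) + 1))) *\<^sub>R e1_direction
    | Some (Inl p) \<Rightarrow> (1 / sqrt (2 * b)) *\<^sub>R E_mat None (Some p)
    | Some (Inr p) \<Rightarrow> (1 / sqrt (2 * b)) *\<^sub>R cscale \<i> (F_mat None (Some p)))"


subsection \<open>The exterior algebra and the spin module\<close>

text \<open>
  An element of the exterior algebra of \<open>span\<^sub>\<complex> {y\<^sub>1, \<dots>, y\<^sub>n}\<close> is the family of its coordinates in the
  basis \<open>y\<^sub>S = y\<^bsub>s1\<^esub> \<and> \<dots> \<and> y\<^bsub>sk\<^esub>\<close>, where \<open>S = {s1 < \<dots> < sk}\<close> ranges over all subsets of \<open>'n\<close>.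
  If \<open>T\<close> and \<open>U\<close> are disjoint then \<open>y\<^sub>T \<and> y\<^sub>U = shuffle_sign T U \<cdot> y\<^bsub>T \<union> U\<^esub>\<close>.
\<close>

type_synonym 'n spinor = "complex ^ 'n set"

definition shuffle_sign :: "'n::linorder set \<Rightarrow> 'n set \<Rightarrow> complex"
  where "shuffle_sign T U = (-1) ^ card {(t, u). t \<in> T \<and> u \<in> U \<and> u < t}"

definition wedge :: "'n::{finite, linorder} spinor \<Rightarrow> 'n spinor \<Rightarrow> 'n spinor"
  where "wedge \<alpha> \<beta> = (\<chi> S. \<Sum>T\<in>Pow S. shuffle_sign T (S - T) * \<alpha> $ T * \<beta> $ (S - T))"

definition ext_one :: "'n::{finite, linorder} spinor"
  where "ext_one = axis {} 1"

definition y_gen :: "'n \<Rightarrow> 'n::{finite, linorder} spinor"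
  where "y_gen j = axis {j} 1"

definition contract :: "'n \<Rightarrow> 'n::{finite, linorder} spinor \<Rightarrow> 'n spinor"
  where "contract j \<eta> = (\<chi> S. if j \<in> S then 0 else shuffle_sign {j} S * \<eta> $ insert j S)"

lemma wedge_y_gen:
  "wedge (y_gen j) \<eta> $ S = (if j \<in> S then shuffle_sign {j} (S - {j}) * \<eta> $ (S - {j}) else 0)"
proof -
  have "wedge (y_gen j) \<eta> $ S
      = (\<Sum>T\<in>Pow S. if T = {j} then shuffle_sign {j} (S - {j}) * \<eta> $ (S - {j}) else 0)"
    by (auto simp: wedge_def y_gen_def axis_def simp del: sum.delta sum.delta' intro!: sum.cong)
  then show ?thesis by (simp add: sum.delta)
qed

lemma shuffle_sign_single: "shuffle_sign {j} S = (-1) ^ card {u \<in> S. u < j}"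
proof -
  have "{(t, u). t \<in> {j} \<and> u \<in> S \<and> u < t} = Pair j ` {u \<in> S. u < j}" by auto
  then show ?thesis by (simp add: shuffle_sign_def card_image inj_on_def)
qed

text \<open>
  The next two facts say that \<open>contract j\<close> is the antiderivation with
  \<open>contract j y\<^sub>k = \<delta>\<^sub>j\<^sub>k\<close>: it kills scalars and obeys the signed Leibniz rule on generators.
\<close>

lemma contract_ext_one: "contract j ext_one = 0"
  by (simp add: vec_eq_iff contract_def ext_one_def axis_def)

lemma contract_wedge_y_gen:
  fixes \<eta> :: "'n::{finite, linorder} spinor"
  shows "contract j (wedge (y_gen k) \<eta>)
     = (if j = k then \<eta> else 0) - wedge (y_gen k) (contract j \<eta>)"
proof -
  have flip: "shuffle_sign {j} (insert k S) = (if k < j then -1 else 1) * shuffle_sign {j} S"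
    if "k \<notin> S" for j k :: 'n and S
  proof -
    have "{u \<in> insert k S. u < j} = (if k < j then insert k {u \<in> S. u < j} else {u \<in> S. u < j})"
      by auto
    with that show ?thesis by (simp add: shuffle_sign_single)
  qed
  have sq: "shuffle_sign {j} S * (shuffle_sign {j} S * z) = z" for j :: 'n and S z
    unfolding shuffle_sign_single mult.assoc [symmetric] power_add [symmetric] by simp
  have "contract j (wedge (y_gen k) \<eta>) $ S
      = ((if j = k then \<eta> else 0) - wedge (y_gen k) (contract j \<eta>)) $ S" for S
  proof (cases "j = k")
    case True
    then show ?thesis
      by (auto simp: contract_def wedge_y_gen sq insert_absorb)
  next
    case False
    show ?thesis
    proof (cases "k \<in> S \<and> j \<notin> S")
      case True
      define R where "R = S - {k}"
      have S: "S = insert k R" "k \<notin> R" "j \<notin> R" using True by (auto simp: R_def)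
      have "insert j S - {k} = insert j R" using S False by auto
      then have "contract j (wedge (y_gen k) \<eta>) $ S
          = shuffle_sign {j} S * (shuffle_sign {k} (insert j R) * \<eta> $ insert j R)"
        using True by (simp add: contract_def wedge_y_gen)
      moreover have "wedge (y_gen k) (contract j \<eta>) $ S
          = shuffle_sign {k} R * (shuffle_sign {j} R * \<eta> $ insert j R)"
        using True S by (simp add: contract_def wedge_y_gen R_def [symmetric])
      moreover have "shuffle_sign {j} S = (if k < j then -1 else 1) * shuffle_sign {j} R"
        unfolding S(1) by (rule flip [OF S(2)])
      moreover have "shuffle_sign {k} (insert j R) = (if j < k then -1 else 1) * shuffle_sign {k} R"
        by (rule flip [OF S(3)])
      moreover have "j < k \<or> k < j" using False by auto
      ultimately show ?thesis using False by auto
    next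
      case False
      then show ?thesis using \<open>j \<noteq> k\<close> by (auto simp: contract_def wedge_y_gen)
    qed
  qed
  then show ?thesis by (simp add: vec_eq_iff)
qed

text \<open>Clifford multiplication by the basis vectors, and its real-linear extension to \<open>m\<close>.\<close>

definition cliff_basis :: "('n + 'n) option \<Rightarrow> 'n::{finite, linorder} spinor \<Rightarrow> 'n spinor"
  where "cliff_basis i \<eta> = (case i of
      None \<Rightarrow> (\<chi> S. (if even (card S) then \<i> else - \<i>) * \<eta> $ S)
    | Some (Inl j) \<Rightarrow> \<i> *s (contract j \<eta> + wedge (y_gen j) \<eta>)
    | Some (Inr j) \<Rightarrow> wedge (y_gen j) \<eta> - contract j \<eta>)"

definition clifford ::
  "real \<Rightarrow> real \<Rightarrow> 'n::{finite, linorder} cmat \<Rightarrow> 'n spinor \<Rightarrow> 'n spinor"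
  where "clifford a b X \<eta> = (\<Sum>i\<in>UNIV. g_metric a b X (e_basis a b i) *\<^sub>R cliff_basis i \<eta>)"

text \<open>
  The spin lift of a skew endomorphism \<open>T\<close> of \<open>m\<close>. With \<open>e\<^sub>i \<and> e\<^sub>j\<close> the map \<open>e\<^sub>i \<mapsto> e\<^sub>j\<close>,
  \<open>e\<^sub>j \<mapsto> - e\<^sub>i\<close>, one has \<open>T = \<Sum>\<^bsub>i<j\<^esub> g(T e\<^sub>i, e\<^sub>j) e\<^sub>i \<and> e\<^sub>j\<close>, with lift
  \<open>\<Sum>\<^bsub>i<j\<^esub> g(T e\<^sub>i, e\<^sub>j) \<cdot> 1/2 e\<^sub>i \<cdot> e\<^sub>j\<close>. Here the sum runs over all ordered pairs instead, which
  counts each unordered pair twice and turns \<open>1/2\<close> into \<open>1/4\<close>; the diagonal terms vanish.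
\<close>

definition spin_lift ::
  "real \<Rightarrow> real \<Rightarrow> ('n::{finite, linorder} cmat \<Rightarrow> 'n cmat) \<Rightarrow> 'n spinor \<Rightarrow> 'n spinor"
  where "spin_lift a b T \<eta> = (\<Sum>i\<in>UNIV. \<Sum>j\<in>UNIV.
           (1 / 4 * g_metric a b (T (e_basis a b i)) (e_basis a b j)) *\<^sub>R
             cliff_basis i (cliff_basis j \<eta>))"


subsection \<open>Invariant spinors, the spin connection, generalized Killing spinors\<close>

definition invariant_spinor :: "real \<Rightarrow> real \<Rightarrow> 'n::{finite, linorder} spinor \<Rightarrow> bool"
  where "invariant_spinor a b \<psi> \<longleftrightarrow> (\<forall>H\<in>h_alg. spin_lift a b (lie_bracket H) \<psi> = 0)"

definition U_map :: "real \<Rightarrow> real \<Rightarrow> 'n::finite cmat \<Rightarrow> 'n cmat \<Rightarrow> 'n cmat"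
  where "U_map a b X Y = (THE W. W \<in> m_space \<and> (\<forall>Z\<in>m_space.
           2 * g_metric a b W Z = g_metric a b (proj m_space (lie_bracket Z X)) Y
                                + g_metric a b X (proj m_space (lie_bracket Z Y))))"

definition Nomizu :: "real \<Rightarrow> real \<Rightarrow> 'n::finite cmat \<Rightarrow> 'n cmat \<Rightarrow> 'n cmat"
  where "Nomizu a b X Y = (1 / 2) *\<^sub>R proj m_space (lie_bracket X Y) + U_map a b X Y"

text \<open>
  The Levi-Civita spin connection on invariant spinors, at the origin. An invariant spinor is a
  constant equivariant map on \<open>SU(n+1)\<close>, so there is no derivative term.
\<close>

definition nabla ::
  "real \<Rightarrow> real \<Rightarrow> 'n::{finite, linorder} cmat \<Rightarrow> 'n spinor \<Rightarrow> 'n spinor"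
  where "nabla a b X \<psi> = spin_lift a b (Nomizu a b X) \<psi>"

definition symmetric_endomorphism ::
  "real \<Rightarrow> real \<Rightarrow> ('n::finite cmat \<Rightarrow> 'n cmat) \<Rightarrow> bool"
  where "symmetric_endomorphism a b A \<longleftrightarrow>
     (\<forall>X\<in>m_space. A X \<in> m_space) \<and>
     (\<forall>X\<in>m_space. \<forall>Y\<in>m_space. A (X + Y) = A X + A Y) \<and>
     (\<forall>c. \<forall>X\<in>m_space. A (c *\<^sub>R X) = c *\<^sub>R A X) \<and>
     (\<forall>X\<in>m_space. \<forall>Y\<in>m_space. g_metric a b (A X) Y = g_metric a b X (A Y))"

definition generalized_Killing_spinor ::
  "real \<Rightarrow> real \<Rightarrow> ('n::{finite, linorder} cmat \<Rightarrow> 'n cmat) \<Rightarrow> 'n spinor \<Rightarrow> bool"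
  where "generalized_Killing_spinor a b A \<psi> \<longleftrightarrow>
     symmetric_endomorphism a b A \<and>
     (\<forall>X\<in>m_space. nabla a b X \<psi> = clifford a b (A X) \<psi>)"

definition psi_plus :: "'n::{finite, linorder} spinor"
  where "psi_plus = ext_one"

text \<open>The product \<open>y\<^sub>1 \<and> \<dots> \<and> y\<^sub>n\<close>, taken in increasing order of the index.\<close>

definition psi_minus :: "'n::{finite, linorder} spinor"
  where "psi_minus = foldr (\<lambda>j \<eta>. wedge (y_gen j) \<eta>) (sorted_list_of_set UNIV) ext_one"

end

theory Submission
  imports Defs
begin

text \<open>
  An element of \<open>m\<close> is a pair \<open>(t, v)\<close> of a real number and a vector of \<open>\<complex>\<^sup>n\<close>: the diagonal
  matrix \<open>it \<cdot> diag(-n, 1, \<dots>, 1)\<close> plus the skew-Hermitian matrix with first column \<open>v\<close>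
  (\<open>m_vec\<close>). In these coordinates the metric is \<open>an(n+1)ts + 2b\<langle>v, w\<rangle>\<close> for the real inner product
  \<open>\<langle>v, w\<rangle>\<close>, and solving for \<open>U\<close> gives the Levi-Civita connection (\<open>Nomizu_m_vec\<close>)
  \<open>(t, v) \<cdot> (s, w) = (\<langle>iv, w\<rangle> / n, (n+1)/(2b) \<cdot> ((2b-a) t iw - a s iv))\<close>.

  On the spinor side, \<open>1\<close> is killed by every contraction and \<open>y\<^sub>1 \<and> \<dots> \<and> y\<^sub>n\<close> by every exterior
  multiplication with a generator. Hence both satisfy \<open>e\<^sub>2\<^sub>q \<cdot> \<psi> = \<epsilon> i e\<^sub>2\<^sub>q\<^sub>+\<^sub>1 \<cdot> \<psi>\<close> for all \<open>q\<close> and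
  \<open>e\<^sub>1 \<cdot> \<psi> = \<delta> i \<psi>\<close>, with \<open>(\<epsilon>, \<delta>) = (1, 1)\<close> and \<open>(\<epsilon>, \<delta>) = (-1, (-1)\<^sup>n)\<close> respectively
  (\<open>polarised\<close>). Everything else uses only these two equations and the Clifford relations, so both
  spinors are treated at once.

  Let \<open>T\<close> be a skew endomorphism of \<open>m\<close> whose block on \<open>m\<^sub>2\<close> commutes with \<open>i\<close>. Its spin lift acts
  on a polarised spinor in a simple way (\<open>spin_lift_polarised\<close>): the \<open>m\<^sub>2\<close>-block acts by
  \<open>\<epsilon>/2\<close> times its complex trace, and the entries between \<open>e\<^sub>1\<close> and \<open>m\<^sub>2\<close> act by \<open>\<epsilon>\<delta>\<close> times a
  single Clifford multiplication by a vector of \<open>m\<^sub>2\<close>.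

  For \<open>T = ad(H)\<close> with \<open>H \<in> su(n)\<close> there are no entries of the second kind and the trace
  vanishes, so \<open>\<psi>\<close> is invariant. For \<open>T\<close> the connection in direction \<open>(t, v)\<close>, the trace is
  \<open>i n(n+1)(2b-a)t / (2b)\<close>, and as \<open>\<epsilon> i \<psi> = \<epsilon>\<delta> e\<^sub>1 \<cdot> \<psi>\<close> it contributes
  \<open>\<epsilon>\<delta> \<lambda>\<^sub>1 (t, 0) \<cdot> \<psi>\<close>; the entries of the second kind contribute \<open>\<epsilon>\<delta> \<lambda>\<^sub>2 (0, v) \<cdot> \<psi>\<close>. The sign
  \<open>\<epsilon>\<delta>\<close> is \<open>1\<close> for \<open>\<psi>\<^sub>+\<close> and \<open>(-1)\<^sup>n\<^sup>+\<^sup>1\<close> for \<open>\<psi>\<^sub>-\<close>.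
\<close>

section \<open>Coordinates on the reductive complement\<close>

definition m_vec :: "real \<Rightarrow> complex ^ 'n \<Rightarrow> 'n::finite cmat"
  where "m_vec t v = (\<chi> r s. case (r, s) of
      (None, None) \<Rightarrow> - \<i> * of_real (real CARD('n) * t)
    | (None, Some q) \<Rightarrow> - cnj (v $ q)
    | (Some p, None) \<Rightarrow> v $ p
    | (Some p, Some q) \<Rightarrow> if p = q then \<i> * of_real t else 0)"

lemma sum_option:
  fixes f :: "'a::finite option \<Rightarrow> 'b::comm_monoid_add"
  shows "(\<Sum>r\<in>UNIV. f r) = f None + (\<Sum>p\<in>UNIV. f (Some p))"
  by (simp add: UNIV_option_conv sum.reindex)

lemma sum_option_Plus:
  fixes f :: "('a::finite + 'a) option \<Rightarrow> 'b::comm_monoid_add"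
  shows "(\<Sum>i\<in>UNIV. f i)
    = f None + ((\<Sum>p\<in>UNIV. f (Some (Inl p))) + (\<Sum>p\<in>UNIV. f (Some (Inr p))))"
  by (simp add: sum_option UNIV_Plus_UNIV [symmetric] sum.Plus del: UNIV_Plus_UNIV)

lemma m_vec_nth [simp]:
  fixes v :: "complex ^ 'n::finite"
  shows "m_vec t v $ None $ None = - \<i> * of_real (real CARD('n) * t)"
    "m_vec t v $ None $ Some q = - cnj (v $ q)"
    "m_vec t v $ Some p $ None = v $ p"
    "m_vec t v $ Some p $ Some q = (if p = q then \<i> * of_real t else 0)"
  by (simp_all add: m_vec_def)

text \<open>
  Every matrix below has its first row and column of a different shape from the lower right block,
  so equalities are checked on these four pieces.
\<close>

lemma cmat_eqI:
  fixes X Y :: "'n::finite cmat"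
  assumes "X $ None $ None = Y $ None $ None"
    and "\<And>q. X $ None $ Some q = Y $ None $ Some q"
    and "\<And>p. X $ Some p $ None = Y $ Some p $ None"
    and "\<And>p q. X $ Some p $ Some q = Y $ Some p $ Some q"
  shows "X = Y"
proof -
  have "X $ r $ s = Y $ r $ s" for r s
    using assms by (cases r; cases s) auto
  then show ?thesis by (simp add: vec_eq_iff)
qed

lemma m_vec_add: "m_vec t v + m_vec s w = m_vec (t + s) (v + w)"
  by (rule cmat_eqI) (simp_all add: algebra_simps)

lemma m_vec_diff: "m_vec t v - m_vec s w = m_vec (t - s) (v - w)"
  by (rule cmat_eqI) (simp_all add: algebra_simps)

lemmas scaleR_complex = scaleR_conv_of_real [where 'a = complex]

lemma m_vec_scaleR: "c *\<^sub>R m_vec t v = m_vec (c * t) (c *\<^sub>R v)"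
  by (rule cmat_eqI) (simp_all add: scaleR_complex)

lemma m_vec_zero [simp]: "m_vec 0 0 = 0"
  by (rule cmat_eqI) simp_all

lemma m_vec_eq_iff [simp]: "m_vec t v = m_vec s w \<longleftrightarrow> t = s \<and> v = w"
proof
  assume eq: "m_vec t v = m_vec s w"
  have "m_vec t v $ None $ None = m_vec s w $ None $ None"
    and "\<And>p. m_vec t v $ Some p $ None = m_vec s w $ Some p $ None"
    by (simp_all only: eq)
  then show "t = s \<and> v = w" by (simp add: vec_eq_iff)
qed simp

lemma B0_add_left: "B0 (X + Y) Z = B0 X Z + B0 Y Z"
  by (simp add: B0_def trace_def matrix_matrix_mult_def distrib_right sum.distrib)

lemma B0_diff_left: "B0 (X - Y) Z = B0 X Z - B0 Y Z"
  using B0_add_left [of "X - Y" Y Z] by (simp add: algebra_simps)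

lemma B0_commute: "B0 X Y = B0 Y X"
  by (simp only: B0_def trace_mul_sym [of X Y])

lemma su_algD:
  assumes "X \<in> su_alg"
  shows "cnj (X $ s $ r) = - X $ r $ s" "trace X = 0"
  using assms by (auto simp: su_alg_def)

lemma B0_self:
  fixes X :: "'n::finite cmat"
  assumes "X \<in> su_alg"
  shows "B0 X X = (\<Sum>r\<in>UNIV. \<Sum>s\<in>UNIV. (cmod (X $ r $ s))\<^sup>2)"
proof -
  have "X $ r $ s * X $ s $ r = - of_real ((cmod (X $ r $ s))\<^sup>2)" for r s
  proof -
    have "X $ s $ r = - cnj (X $ r $ s)" using su_algD(1) [OF assms, of r s] by simp
    then show ?thesis by (simp flip: complex_norm_square)
  qed
  then show ?thesis
    by (simp add: B0_def trace_def matrix_matrix_mult_def sum_negf)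
qed

text \<open>Positive definiteness is what makes the orthogonal projections well defined.\<close>

lemma B0_self_eq_0:
  fixes X :: "'n::finite cmat"
  assumes "X \<in> su_alg" "B0 X X = 0"
  shows "X = 0"
proof -
  have "(\<Sum>s\<in>UNIV. (cmod (X $ r $ s))\<^sup>2) = 0" for r
    using assms by (simp add: B0_self sum_nonneg_eq_0_iff sum_nonneg)
  then have "cmod (X $ r $ s) = 0" for r s
    by (simp add: sum_nonneg_eq_0_iff)
  then show ?thesis by (simp add: vec_eq_iff)
qed

lemma subspace_su_alg: "subspace su_alg"
proof (rule subspaceI)
  show "0 \<in> su_alg" by (simp add: su_alg_def trace_def)
  show "X + Y \<in> su_alg" if "X \<in> su_alg" "Y \<in> su_alg" for X Y
    using that by (simp add: su_alg_def trace_add)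
  show "c *\<^sub>R X \<in> su_alg" if "X \<in> su_alg" for c X
    using that by (simp add: su_alg_def trace_def scaleR_sum_right [symmetric])
qed

lemma lie_bracket_su_alg:
  assumes "X \<in> su_alg" "Y \<in> su_alg"
  shows "lie_bracket X Y \<in> su_alg"
proof -
  have "cnj (lie_bracket X Y $ s $ r) = - lie_bracket X Y $ r $ s" for r s
    by (simp add: lie_bracket_def matrix_matrix_mult_def su_algD(1) [OF assms(1)]
        su_algD(1) [OF assms(2)] mult.commute)
  moreover have "trace (lie_bracket X Y) = 0"
    by (simp add: lie_bracket_def trace_sub trace_mul_sym [of X Y])
  ultimately show ?thesis by (simp add: su_alg_def)
qed

lemma m_vec_su_alg: "m_vec t v \<in> su_alg"
proof -
  have "cnj (m_vec t v $ s $ r) = - m_vec t v $ r $ s" for r s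
    by (cases r; cases s) auto
  then show ?thesis by (simp add: su_alg_def trace_def sum_option)
qed

lemma B0_m_vec:
  fixes v w :: "complex ^ 'n::finite"
  shows "B0 (m_vec t v) (m_vec s w)
    = real CARD('n) * (real CARD('n) + 1) * t * s + 2 * (v \<bullet> w)"
proof -
  have "B0 (m_vec t v) (m_vec s w) = real CARD('n) * (real CARD('n) + 1) * t * s
      + ((\<Sum>p\<in>UNIV. Re (cnj (v $ p) * w $ p)) + (\<Sum>p\<in>UNIV. Re (v $ p * cnj (w $ p))))"
    by (simp add: B0_def trace_def matrix_matrix_mult_def sum_option sum_negf sum.distrib
        if_distrib [of "\<lambda>x. x * _"] if_distrib [of Re] cong: if_cong)
      (simp add: algebra_simps)
  moreover have "Re (cnj x * y) = x \<bullet> y" "Re (x * cnj y) = x \<bullet> y" for x y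
    by (simp_all add: inner_complex_def)
  ultimately show ?thesis by (simp only: inner_vec_def mult_2 add.assoc)
qed

lemma h_algD:
  fixes H :: "'n::finite cmat"
  assumes "H \<in> h_alg"
  shows "H \<in> su_alg" "H $ None $ r = 0" "H $ r $ None = 0" "(\<Sum>p\<in>UNIV. H $ Some p $ Some p) = 0"
proof -
  show *: "H \<in> su_alg" "H $ None $ r = 0" "H $ r $ None = 0" using assms by (auto simp: h_alg_def)
  show "(\<Sum>p\<in>UNIV. H $ Some p $ Some p) = 0"
    using su_algD(2) [OF *(1)] assms by (simp add: trace_def sum_option h_alg_def)
qed

lemma B0_m_vec_h_alg:
  assumes "H \<in> h_alg"
  shows "B0 (m_vec t v) H = 0"
proof -
  have "trace (m_vec t v ** H) = \<i> * of_real t * (\<Sum>p\<in>UNIV. H $ Some p $ Some p)"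
    by (simp add: trace_def matrix_matrix_mult_def sum_option h_algD(2,3) [OF assms]
        sum_distrib_left if_distrib [of "\<lambda>x. x * _"] cong: if_cong)
  then show ?thesis by (simp add: B0_def h_algD(4) [OF assms])
qed

text \<open>
  The coordinates of the \<open>m\<close>-component are read off from the first column, because \<open>h\<close> has
  vanishing first row and column.
\<close>

lemma su_alg_decomposition:
  fixes X :: "'n::finite cmat"
  assumes "X \<in> su_alg"
  shows "X - m_vec (- Im (X $ None $ None) / real CARD('n)) (\<chi> p. X $ Some p $ None) \<in> h_alg"
    (is "X - ?M \<in> _")
proof -
  have "X - ?M \<in> su_alg"
    by (intro subspace_diff [OF subspace_su_alg] assms m_vec_su_alg)
  moreover have "Re (X $ None $ None) = 0"
    using su_algD(1) [OF assms, of None None] by (simp add: complex_eq_iff)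
  then have "(X - ?M) $ None $ None = 0"
    by (simp add: complex_eq_iff)
  moreover have "(X - ?M) $ None $ Some q = 0" for q
    using su_algD(1) [OF assms, of "Some q" None] by simp
  moreover have "(X - ?M) $ Some q $ None = 0" for q
    by simp
  ultimately show ?thesis unfolding h_alg_def by (simp add: split_option_all)
qed

text \<open>
  Subtracting from \<open>X \<in> m\<close> the coordinate vector read off from its first column leaves an element of
  \<open>h\<close> that is orthogonal to \<open>h\<close>, hence to itself.
\<close>

lemma m_space_eq: "m_space = range (\<lambda>(t, v). m_vec t v :: 'n::finite cmat)"
proof (intro equalityI subsetI)
  fix X :: "'n cmat" assume "X \<in> m_space"
  then have X: "X \<in> su_alg" "\<And>H. H \<in> h_alg \<Longrightarrow> B0 X H = 0" by (auto simp: m_space_def)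
  define t where "t = - Im (X $ None $ None) / real CARD('n)"
  define v where "v = (\<chi> p. X $ Some p $ None)"
  have H: "X - m_vec t v \<in> h_alg"
    unfolding t_def v_def by (rule su_alg_decomposition [OF X(1)])
  then have "B0 (X - m_vec t v) (X - m_vec t v) = 0"
    by (simp add: B0_diff_left X(2) B0_m_vec_h_alg)
  with h_algD(1) [OF H] have "X - m_vec t v = 0" by (rule B0_self_eq_0)
  then show "X \<in> range (\<lambda>(t, v). m_vec t v)" by auto
qed (auto simp: m_space_def m_vec_su_alg B0_m_vec_h_alg)

lemma m_spaceE:
  assumes "X \<in> m_space"
  obtains t v where "X = m_vec t v"
  using assms by (auto simp: m_space_eq)

lemma e1_direction_eq: "e1_direction = (m_vec 1 0 :: 'n::finite cmat)"
proof -
  have diag: "(\<Sum>l\<in>UNIV. cscale \<i> (F_mat (Some l) (Some l))) $ r $ s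
      = (case r of None \<Rightarrow> 0 | Some p \<Rightarrow> if s = Some p then \<i> else 0)" for r s :: "'n option"
  proof (cases r)
    case None
    then show ?thesis by (simp add: cscale_def F_mat_def)
  next
    case (Some p)
    have "(\<Sum>l\<in>UNIV. cscale \<i> (F_mat (Some l) (Some l)) $ r $ s)
        = (\<Sum>l\<in>UNIV. if l = p then if s = Some p then \<i> else 0 else 0)"
      by (intro sum.cong) (auto simp: Some cscale_def F_mat_def)
    then show ?thesis by (simp add: Some)
  qed
  show ?thesis
    unfolding e1_direction_def
    by (rule cmat_eqI)
      (simp_all del: sum_component add: diag, simp_all add: cscale_def F_mat_def scaleR_complex)
qed

lemma E_mat_eq: "E_mat None (Some p) = m_vec 0 (axis p 1)"
  by (rule cmat_eqI) (auto simp: E_mat_def axis_def)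

lemma F_mat_eq: "cscale \<i> (F_mat None (Some p)) = m_vec 0 (axis p \<i>)"
  by (rule cmat_eqI) (auto simp: cscale_def F_mat_def axis_def)

lemma m1_space_eq: "m1_space = range (\<lambda>t. m_vec t 0)"
  by (simp add: m1_space_def e1_direction_eq span_singleton m_vec_scaleR)

lemma linear_m_vec_0: "linear (m_vec 0)"
  by (rule linearI) (simp_all add: m_vec_add m_vec_scaleR)

text \<open>
  The generators of \<open>m\<^sub>2\<close> are the images under \<open>m_vec 0\<close> of the standard real basis of \<open>\<complex>\<^sup>n\<close>.
\<close>

lemma m2_space_eq: "m2_space = range (\<lambda>v. m_vec 0 v :: 'n::finite cmat)"
proof -
  have "range (\<lambda>p. axis p 1) \<union> range (\<lambda>p. axis p \<i>) = (Basis :: (complex ^ 'n) set)"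
    by (auto simp: Basis_vec_def Basis_complex_def)
  then have "m2_space = span (m_vec 0 ` (Basis :: (complex ^ 'n) set))"
    unfolding m2_space_def E_mat_eq F_mat_eq by (metis image_Un image_image)
  also have "\<dots> = m_vec 0 ` span Basis"
    by (rule span_linear_image [OF linear_m_vec_0])
  finally show ?thesis by simp
qed

section \<open>Orthogonal projections and the metric\<close>

lemma proj_eqI:
  assumes "subspace W" "W \<subseteq> su_alg" "Y \<in> W" "\<And>Z. Z \<in> W \<Longrightarrow> B0 (X - Y) Z = 0"
  shows "proj W X = Y"
  unfolding proj_def
proof (rule the_equality)
  show "Y \<in> W \<and> (\<forall>Z\<in>W. B0 (X - Y) Z = 0)" using assms by blast
next
  fix Y' assume Y': "Y' \<in> W \<and> (\<forall>Z\<in>W. B0 (X - Y') Z = 0)"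
  have D: "Y' - Y \<in> W" using Y' assms by (simp add: subspace_diff)
  have "B0 (Y' - Y) (Y' - Y) = B0 (X - Y) (Y' - Y) - B0 (X - Y') (Y' - Y)"
    by (simp add: B0_diff_left)
  then have "B0 (Y' - Y) (Y' - Y) = 0" using D Y' assms(4) by simp
  then show "Y' = Y" using D assms(2) B0_self_eq_0 by fastforce
qed

lemma subspace_m_space: "subspace m_space"
proof (rule subspaceI)
  show "0 \<in> m_space" unfolding m_space_eq by (rule image_eqI [of _ _ "(0, 0)"]) auto
qed (auto simp: m_space_eq m_vec_add m_vec_scaleR image_iff)

lemma subspace_m1_space: "subspace m1_space" and subspace_m2_space: "subspace m2_space"
  by (simp_all add: m1_space_def m2_space_def)

text \<open>
  The case \<open>H \<noteq> 0\<close> matters for brackets, which leave \<open>m\<close>: only their \<open>m\<close>-component is kept.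
\<close>

lemma proj_m_vec_add_h_alg:
  assumes "H \<in> h_alg"
  shows "proj m1_space (m_vec t v + H) = m_vec t 0"
    and "proj m2_space (m_vec t v + H) = m_vec 0 v"
    and "proj m_space (m_vec t v + H) = m_vec t v"
proof -
  have B0_h: "B0 H (m_vec s w) = 0" for s w
    using B0_m_vec_h_alg [OF assms] by (simp add: B0_commute)
  have *: "B0 (m_vec t v + H - m_vec s w) (m_vec s' w') = B0 (m_vec (t - s) (v - w)) (m_vec s' w')"
    for s w s' w'
    by (simp add: B0_add_left B0_diff_left m_vec_diff [symmetric] B0_h)
  show "proj m1_space (m_vec t v + H) = m_vec t 0"
    by (rule proj_eqI [OF subspace_m1_space]) (auto simp: m1_space_eq * B0_h m_vec_su_alg B0_m_vec)
  show "proj m2_space (m_vec t v + H) = m_vec 0 v"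
    by (rule proj_eqI [OF subspace_m2_space]) (auto simp: m2_space_eq * B0_h m_vec_su_alg B0_m_vec)
  show "proj m_space (m_vec t v + H) = m_vec t v"
    by (rule proj_eqI [OF subspace_m_space]) (auto simp: m_space_eq * B0_h m_vec_su_alg B0_m_vec)
qed

lemma h_alg_0: "0 \<in> h_alg"
  using subspace_0 [OF subspace_su_alg] by (simp add: h_alg_def)

lemmas proj_m_vec = proj_m_vec_add_h_alg [OF h_alg_0, simplified]

lemma proj_m_space_su_alg:
  fixes X :: "'n::finite cmat"
  assumes "X \<in> su_alg"
  shows "proj m_space X = m_vec (- Im (X $ None $ None) / real CARD('n)) (\<chi> p. X $ Some p $ None)"
    (is "_ = ?M")
proof -
  have "proj m_space (?M + (X - ?M)) = ?M"
    by (rule proj_m_vec_add_h_alg(3) [OF su_alg_decomposition [OF assms]])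
  moreover have "?M + (X - ?M) = X" by (rule add.commute [THEN trans, OF diff_add_cancel])
  ultimately show ?thesis by (simp only:)
qed

lemma g_metric_m_vec:
  fixes v w :: "complex ^ 'n::finite"
  shows "g_metric a b (m_vec t v) (m_vec s w)
    = a * (real CARD('n) * (real CARD('n) + 1)) * t * s + 2 * b * (v \<bullet> w)"
  by (simp add: g_metric_def proj_m_vec B0_m_vec)

lemma e_basis_m_vec:
  shows "e_basis a b None
      = (m_vec (1 / sqrt (a * real CARD('n) * (real CARD('n) + 1))) 0 :: 'n::finite cmat)"
    and "e_basis a b (Some (Inl p)) = m_vec 0 (axis p (of_real (1 / sqrt (2 * b))))"
    and "e_basis a b (Some (Inr p)) = m_vec 0 (axis p (\<i> * of_real (1 / sqrt (2 * b))))"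
  by (simp_all add: e_basis_def e1_direction_eq E_mat_eq F_mat_eq m_vec_scaleR)
    (simp_all add: vec_eq_iff axis_def scaleR_complex)

section \<open>The Levi-Civita connection\<close>

text \<open>
  The form \<open>\<langle>iv, w\<rangle>\<close> in the \<open>m\<^sub>1\<close>-component is the Kaehler form of \<open>\<complex>\<^sup>n\<close>; it comes from the first
  diagonal entry of the bracket, which is \<open>-in\<close> times the \<open>m\<^sub>1\<close>-coordinate.
\<close>

lemma proj_lie_bracket_m_vec:
  fixes v w :: "complex ^ 'n::finite"
  shows "proj m_space (lie_bracket (m_vec t v) (m_vec s w))
    = m_vec (2 * ((\<i> *s v) \<bullet> w) / real CARD('n))
        ((real CARD('n) + 1) *\<^sub>R (\<i> *s (t *\<^sub>R w - s *\<^sub>R v)))"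
proof -
  have "Im (lie_bracket (m_vec t v) (m_vec s w) $ None $ None) = - 2 * ((\<i> *s v) \<bullet> w)"
    by (simp add: lie_bracket_def matrix_matrix_mult_def sum_option inner_vec_def inner_complex_def
        sum_negf sum_subtractf [symmetric] sum_distrib_left algebra_simps)
  moreover have "lie_bracket (m_vec t v) (m_vec s w) $ Some p $ None
      = ((real CARD('n) + 1) *\<^sub>R (\<i> *s (t *\<^sub>R w - s *\<^sub>R v))) $ p" for p
    by (simp add: lie_bracket_def matrix_matrix_mult_def sum_option scaleR_complex
        if_distrib [of "\<lambda>x. x * _"] cong: if_cong) (simp add: algebra_simps)
  ultimately show ?thesis
    unfolding proj_m_space_su_alg [OF lie_bracket_su_alg [OF m_vec_su_alg m_vec_su_alg]]
    by (simp only: m_vec_eq_iff vec_eq_iff vec_lambda_beta) simp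
qed

lemma inner_i_skew: "(\<i> *s v) \<bullet> w = - (v \<bullet> (\<i> *s w))" for v w :: "complex ^ 'n::finite"
  by (simp add: inner_vec_def inner_complex_def sum_negf [symmetric])

lemma i_smult_linear:
  fixes v w :: "complex ^ 'n::finite"
  shows "\<i> *s (v + w) = \<i> *s v + \<i> *s w"
    "\<i> *s (v - w) = \<i> *s v - \<i> *s w"
    "\<i> *s (c *\<^sub>R v) = c *\<^sub>R (\<i> *s v)"
  by (simp_all add: vec_eq_iff algebra_simps)

text \<open>Nondegeneracy of the metric makes \<open>U\<close> unique.\<close>

lemma g_metric_m_vec_eq_0:
  fixes v :: "complex ^ 'n::finite"
  assumes "a > 0" "b > 0" "g_metric a b (m_vec t v) (m_vec t v) = 0"
  shows "t = 0 \<and> v = 0"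
proof -
  define k where "k = a * (real CARD('n) * (real CARD('n) + 1))"
  have "k > 0" unfolding k_def using assms(1) by (intro mult_pos_pos) simp_all
  moreover have "k * t\<^sup>2 + 2 * b * (v \<bullet> v) = 0"
    using assms(3) by (simp add: g_metric_m_vec k_def power2_eq_square)
  moreover have "k * t\<^sup>2 \<ge> 0" "2 * b * (v \<bullet> v) \<ge> 0" using \<open>k > 0\<close> assms(2) by simp_all
  ultimately have "k * t\<^sup>2 = 0" "2 * b * (v \<bullet> v) = 0" by linarith+
  with \<open>k > 0\<close> assms(2) show ?thesis by simp
qed

text \<open>
  Testing against \<open>Z = (r, z)\<close>, the terms with \<open>r\<close> cancel because the Kaehler form is skew; what is
  left is \<open>2(n+1)(a-b) \<langle>iz, s v + t w\<rangle>\<close>. So \<open>U\<close> lies in \<open>m\<^sub>2\<close>, and it vanishes for \<open>a = b\<close>.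
\<close>

lemma U_map_m_vec:
  fixes v w :: "complex ^ 'n::finite"
  assumes "a > 0" "b > 0"
  shows "U_map a b (m_vec t v) (m_vec s w)
    = m_vec 0 (((real CARD('n) + 1) * (b - a) / (2 * b)) *\<^sub>R (\<i> *s (s *\<^sub>R v + t *\<^sub>R w)))"
    (is "_ = ?U")
proof -
  let ?rhs = "\<lambda>Z. g_metric a b (proj m_space (lie_bracket Z (m_vec t v))) (m_vec s w)
    + g_metric a b (m_vec t v) (proj m_space (lie_bracket Z (m_vec s w)))"
  have U: "2 * g_metric a b ?U (m_vec r z) = ?rhs (m_vec r z)" for r z
  proof -
    have "(\<i> *s z) \<bullet> v = - ((\<i> *s v) \<bullet> z)" "(\<i> *s z) \<bullet> w = - ((\<i> *s w) \<bullet> z)"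
       "v \<bullet> (\<i> *s w) = - ((\<i> *s v) \<bullet> w)"
       "v \<bullet> (\<i> *s z) = - ((\<i> *s v) \<bullet> z)"
      by (metis inner_i_skew inner_commute)+
    then show ?thesis
      using assms by (simp add: proj_lie_bracket_m_vec g_metric_m_vec i_smult_linear inner_simps)
         (simp add: field_simps)
  qed
  show ?thesis
    unfolding U_map_def
  proof (rule the_equality)
    show "?U \<in> m_space \<and> (\<forall>Z\<in>m_space. 2 * g_metric a b ?U Z = ?rhs Z)"
      using U by (auto simp: m_space_eq)
  next
    \<comment> \<open>Two solutions pair equally with every vector, so their difference has length zero.\<close>
    fix W assume W: "W \<in> m_space \<and> (\<forall>Z\<in>m_space. 2 * g_metric a b W Z = ?rhs Z)"
    then obtain r z where Wrz: "W = m_vec r z" by (auto elim: m_spaceE)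
    define u where "u = ((real CARD('n) + 1) * (b - a) / (2 * b)) *\<^sub>R (\<i> *s (s *\<^sub>R v + t *\<^sub>R w))"
    have "2 * g_metric a b W (m_vec x y) = 2 * g_metric a b ?U (m_vec x y)" for x y
      using W U [of x y] by (auto simp: m_space_eq)
    then have eq: "g_metric a b (m_vec r z) (m_vec x y) = g_metric a b (m_vec 0 u) (m_vec x y)" for x y
      by (simp add: Wrz u_def)
    have "g_metric a b (m_vec r (z - u)) (m_vec r (z - u))
        = g_metric a b (m_vec r z) (m_vec r (z - u)) - g_metric a b (m_vec 0 u) (m_vec r (z - u))"
      by (simp add: g_metric_m_vec inner_diff_left algebra_simps)
    then have "g_metric a b (m_vec r (z - u)) (m_vec r (z - u)) = 0" by (simp add: eq)
    from g_metric_m_vec_eq_0 [OF assms this] show "W = ?U" by (simp add: Wrz u_def)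
  qed
qed

lemma Nomizu_m_vec:
  fixes v w :: "complex ^ 'n::finite"
  assumes "a > 0" "b > 0"
  shows "Nomizu a b (m_vec t v) (m_vec s w)
    = m_vec (((\<i> *s v) \<bullet> w) / real CARD('n))
        (((real CARD('n) + 1) * (2 * b - a) / (2 * b) * t) *\<^sub>R (\<i> *s w)
          - ((real CARD('n) + 1) * a / (2 * b) * s) *\<^sub>R (\<i> *s v))"
proof -
  have "(1 / 2 * (real CARD('n) + 1)) *\<^sub>R (\<i> *s (t *\<^sub>R w - s *\<^sub>R v))
      + ((real CARD('n) + 1) * (b - a) / (2 * b)) *\<^sub>R (\<i> *s (s *\<^sub>R v + t *\<^sub>R w))
    = ((real CARD('n) + 1) * (2 * b - a) / (2 * b) * t) *\<^sub>R (\<i> *s w)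
          - ((real CARD('n) + 1) * a / (2 * b) * s) *\<^sub>R (\<i> *s v)"
    using assms by (simp add: vec_eq_iff complex_eq_iff field_simps)
  then show ?thesis
    unfolding Nomizu_def U_map_m_vec [OF assms] proj_lie_bracket_m_vec m_vec_scaleR m_vec_add
    by simp
qed

text \<open>The isotropy representation: trivial on \<open>m\<^sub>1\<close> and the standard one of \<open>su(n)\<close> on \<open>m\<^sub>2 = \<complex>\<^sup>n\<close>.\<close>

lemma lie_bracket_h_alg_m_vec:
  fixes H :: "'n::finite cmat"
  assumes "H \<in> h_alg"
  shows "lie_bracket H (m_vec t v) = m_vec 0 (\<chi> p. \<Sum>q\<in>UNIV. H $ Some p $ Some q * v $ q)"
proof (rule cmat_eqI)
  have cnj_H: "cnj (H $ r $ s) = - H $ s $ r" for r s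
    using su_algD(1) [OF h_algD(1) [OF assms]] .
  show "lie_bracket H (m_vec t v) $ None $ Some q
      = m_vec 0 (\<chi> p. \<Sum>q\<in>UNIV. H $ Some p $ Some q * v $ q) $ None $ Some q" for q
    by (simp add: lie_bracket_def matrix_matrix_mult_def sum_option h_algD(2,3) [OF assms] cnj_H
        sum_negf mult.commute)
  show "lie_bracket H (m_vec t v) $ Some p $ Some q
      = m_vec 0 (\<chi> p. \<Sum>q\<in>UNIV. H $ Some p $ Some q * v $ q) $ Some p $ Some q" for p q
    by (simp add: lie_bracket_def matrix_matrix_mult_def sum_option h_algD(2,3) [OF assms]
        if_distrib [of "\<lambda>x. x * _"] if_distrib [of "\<lambda>x. H $ _ $ _ * x"] cong: if_cong)
qed (simp_all add: lie_bracket_def matrix_matrix_mult_def sum_option h_algD(2,3) [OF assms])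

section \<open>Clifford multiplication\<close>

lemma shuffle_sign_insert:
  fixes j k :: "'n::{finite, linorder}"
  assumes "k \<notin> S"
  shows "shuffle_sign {j} (insert k S) = (if k < j then -1 else 1) * shuffle_sign {j} S"
proof -
  have "{u \<in> insert k S. u < j} = (if k < j then insert k {u \<in> S. u < j} else {u \<in> S. u < j})"
    by auto
  with assms show ?thesis by (simp add: shuffle_sign_single)
qed

text \<open>
  Of two distinct indices exactly one has to pass the other, so the two orders of insertion into \<open>R\<close>
  differ by one sign.
\<close>

lemma shuffle_sign_swap:
  fixes j k :: "'n::{finite, linorder}"
  assumes "j \<noteq> k" "j \<notin> R" "k \<notin> R"
  shows "shuffle_sign {j} (insert k R) * shuffle_sign {k} R
    = - (shuffle_sign {k} (insert j R) * shuffle_sign {j} R)"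
  using assms by (cases "j < k") (auto simp: shuffle_sign_insert)

lemma wedge_y_gen_anticommute:
  fixes \<eta> :: "'n::{finite, linorder} spinor"
  shows "wedge (y_gen j) (wedge (y_gen k) \<eta>) = - wedge (y_gen k) (wedge (y_gen j) \<eta>)"
proof -
  have "wedge (y_gen j) (wedge (y_gen k) \<eta>) $ S = - wedge (y_gen k) (wedge (y_gen j) \<eta>) $ S" for S
  proof (cases "j \<noteq> k \<and> j \<in> S \<and> k \<in> S")
    case True
    define R where "R = S - {j, k}"
    have R: "S - {j} = insert k R" "S - {k} = insert j R" "insert k R - {k} = R"
      "insert j R - {j} = R"
      using True by (auto simp: R_def)
    have "wedge (y_gen j) (wedge (y_gen k) \<eta>) $ S
        = (shuffle_sign {j} (insert k R) * shuffle_sign {k} R) * \<eta> $ R"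
      using True unfolding wedge_y_gen R by (simp add: R mult.assoc)
    moreover have "wedge (y_gen k) (wedge (y_gen j) \<eta>) $ S
        = (shuffle_sign {k} (insert j R) * shuffle_sign {j} R) * \<eta> $ R"
      using True unfolding wedge_y_gen R by (simp add: R mult.assoc)
    moreover have "j \<noteq> k" "j \<notin> R" "k \<notin> R" using True by (auto simp: R_def)
    ultimately show ?thesis by (simp add: shuffle_sign_swap [of j k R])
  next
    case False
    then show ?thesis by (auto simp: wedge_y_gen)
  qed
  then show ?thesis by (simp add: vec_eq_iff)
qed

lemma contract_anticommute:
  fixes \<eta> :: "'n::{finite, linorder} spinor"
  shows "contract j (contract k \<eta>) = - contract k (contract j \<eta>)"
proof -
  have "contract j (contract k \<eta>) $ S = - contract k (contract j \<eta>) $ S" for S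
  proof (cases "j \<noteq> k \<and> j \<notin> S \<and> k \<notin> S")
    case True
    then have "contract j (contract k \<eta>) $ S
        = (shuffle_sign {k} (insert j S) * shuffle_sign {j} S) * \<eta> $ insert j (insert k S)"
      by (auto simp: contract_def insert_commute [of k j])
    moreover have "contract k (contract j \<eta>) $ S
        = (shuffle_sign {j} (insert k S) * shuffle_sign {k} S) * \<eta> $ insert j (insert k S)"
      using True by (simp add: contract_def)
    ultimately show ?thesis using True by (simp add: shuffle_sign_swap [of j k S])
  next
    case False
    then show ?thesis by (auto simp: contract_def)
  qed
  then show ?thesis by (simp add: vec_eq_iff)
qed

lemma contract_linear:
  "contract j (\<eta> + \<theta>) = contract j \<eta> + contract j \<theta>"
  "contract j (\<eta> - \<theta>) = contract j \<eta> - contract j \<theta>"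
  "contract j (c *s \<eta>) = c *s contract j \<eta>"
  by (simp_all add: vec_eq_iff contract_def algebra_simps)

lemma wedge_y_gen_linear:
  "wedge (y_gen j) (\<eta> + \<theta>) = wedge (y_gen j) \<eta> + wedge (y_gen j) \<theta>"
  "wedge (y_gen j) (\<eta> - \<theta>) = wedge (y_gen j) \<eta> - wedge (y_gen j) \<theta>"
  "wedge (y_gen j) (c *s \<eta>) = c *s wedge (y_gen j) \<eta>"
  by (simp_all add: vec_eq_iff wedge_y_gen algebra_simps)

lemma cliff_basis_smult: "cliff_basis i (c *s \<eta>) = c *s cliff_basis i \<eta>"
  by (auto simp: cliff_basis_def contract_linear wedge_y_gen_linear vec_eq_iff algebra_simps
      split: option.split sum.split)

text \<open>
  The vector \<open>e\<^sub>1\<close> acts by \<open>\<plusminus>i\<close> according to parity, and the other basis vectors change the parity.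
\<close>

lemma cliff_basis_None_anticommute:
  "cliff_basis None (cliff_basis (Some i) \<eta>) = - cliff_basis (Some i) (cliff_basis None \<eta>)"
proof -
  have minus: "even (card (S - {j})) = odd (card S)" if "j \<in> S" for j :: 'a and S
    using card_Suc_Diff1 [OF finite that] by (metis even_Suc)
  have "cliff_basis None (cliff_basis (Some i) \<eta>) $ S
      = - cliff_basis (Some i) (cliff_basis None \<eta>) $ S" for S
  proof (cases i)
    case (Inl j)
    then show ?thesis
      by (cases "j \<in> S"; cases "even (card S)")
        (auto simp: cliff_basis_def contract_def wedge_y_gen minus mult_ac)
  next
    case (Inr j)
    then show ?thesis
      by (cases "j \<in> S"; cases "even (card S)")
        (auto simp: cliff_basis_def contract_def wedge_y_gen minus mult_ac)
  qed
  then show ?thesis by (simp add: vec_eq_iff)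
qed

lemma cliff_basis_Inl_Inr_anticommute:
  "cliff_basis (Some (Inl p)) (cliff_basis (Some (Inr q)) \<eta>)
    = - cliff_basis (Some (Inr q)) (cliff_basis (Some (Inl p)) \<eta>)"
  by (simp add: cliff_basis_def contract_linear wedge_y_gen_linear contract_wedge_y_gen
      contract_anticommute [of q p] wedge_y_gen_anticommute [of q p])

lemma cliff_basis_Inr_Inr_anticommute:
  "cliff_basis (Some (Inr p)) (cliff_basis (Some (Inr q)) \<eta>)
      + cliff_basis (Some (Inr q)) (cliff_basis (Some (Inr p)) \<eta>)
    = (if p = q then - 2 else 0) *s \<eta>"
  by (simp add: cliff_basis_def contract_linear wedge_y_gen_linear contract_wedge_y_gen
      contract_anticommute [of q p] wedge_y_gen_anticommute [of q p])
    (auto simp: vec_eq_iff algebra_simps)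

section \<open>Polarised spinors\<close>

text \<open>
  For \<open>\<epsilon> = 1\<close> the first condition says that all contractions kill \<open>\<psi>\<close>, for \<open>\<epsilon> = -1\<close> that all
  \<open>y\<^sub>q \<and> \<psi>\<close> vanish. The second condition fixes the parity of \<open>\<psi>\<close>. The signs are kept as variables so
  that both cases can be computed together.
\<close>

definition polarised :: "real \<Rightarrow> real \<Rightarrow> 'n::{finite, linorder} spinor \<Rightarrow> bool"
  where "polarised \<epsilon> \<delta> \<psi> \<longleftrightarrow>
    (\<forall>q. cliff_basis (Some (Inl q)) \<psi> = (of_real \<epsilon> * \<i>) *s cliff_basis (Some (Inr q)) \<psi>) \<and>
    cliff_basis None \<psi> = (of_real \<delta> * \<i>) *s \<psi> \<and> \<epsilon> * \<epsilon> = 1 \<and> \<delta> * \<delta> = 1"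

lemma polarised_psi_plus: "polarised 1 1 psi_plus"
  unfolding polarised_def psi_plus_def
  by (simp add: cliff_basis_def contract_ext_one) (simp add: vec_eq_iff ext_one_def axis_def)

text \<open>
  The sign of the product does not matter: it is enough that \<open>y\<^sub>1 \<and> \<dots> \<and> y\<^sub>n\<close> has its only coordinate at
  the full index set.
\<close>

lemma foldr_wedge_y_gen_nth:
  assumes "S \<noteq> set js"
  shows "foldr (\<lambda>j \<eta>. wedge (y_gen j) \<eta>) js ext_one $ S = 0"
  using assms
proof (induction js arbitrary: S)
  case Nil
  then show ?case by (simp add: ext_one_def axis_def)
next
  case (Cons j js)
  have "S - {j} \<noteq> set js" if "j \<in> S" using Cons.prems that by auto
  then show ?case by (auto simp: wedge_y_gen Cons.IH)
qed

lemma psi_minus_nth: "S \<noteq> UNIV \<Longrightarrow> psi_minus $ S = 0"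
  by (simp add: psi_minus_def foldr_wedge_y_gen_nth)

lemma polarised_psi_minus:
  "polarised (- 1) ((- 1) ^ CARD('n)) (psi_minus :: 'n::{finite, linorder} spinor)"
proof -
  have "wedge (y_gen j) psi_minus $ S = 0" for j and S :: "'n set"
    using psi_minus_nth [of "S - {j}"] by (auto simp: wedge_y_gen)
  then have "wedge (y_gen j) psi_minus = 0" for j :: 'n
    by (simp add: vec_eq_iff)
  then have "cliff_basis (Some (Inl j)) psi_minus = - \<i> *s cliff_basis (Some (Inr j)) psi_minus"
    for j :: 'n
    by (simp add: cliff_basis_def)
  moreover have "cliff_basis None psi_minus $ S = (of_real ((- 1) ^ CARD('n)) * \<i>) * psi_minus $ S"
    for S :: "'n set"
    by (cases "S = UNIV") (simp_all add: cliff_basis_def psi_minus_nth)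
  ultimately show ?thesis
    by (simp add: polarised_def vec_eq_iff flip: power_mult_distrib)
qed

text \<open>
  These are the combinations of products that occur in spin lifts of endomorphisms commuting with \<open>i\<close>
  on \<open>m\<^sub>2\<close>. Replacing \<open>e\<^sub>2\<^sub>q \<cdot> \<psi>\<close> by \<open>\<epsilon> i e\<^sub>2\<^sub>q\<^sub>+\<^sub>1 \<cdot> \<psi>\<close>, moving it past the other factor, and replacing again
  turns the first two into anticommutators of the \<open>e\<^sub>2\<^sub>p\<^sub>+\<^sub>1\<close>, which are scalars. In the last two,
  \<open>e\<^sub>1\<close> is moved to the right, where it acts as a scalar.
\<close>

lemma polarised_Clifford_products:
  assumes "polarised \<epsilon> \<delta> \<psi>"
  shows "cliff_basis (Some (Inl p)) (cliff_basis (Some (Inl q)) \<psi>)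
      + cliff_basis (Some (Inr p)) (cliff_basis (Some (Inr q)) \<psi>) = (if p = q then - 2 else 0) *s \<psi>"
    and "cliff_basis (Some (Inl p)) (cliff_basis (Some (Inr q)) \<psi>)
      - cliff_basis (Some (Inr p)) (cliff_basis (Some (Inl q)) \<psi>)
      = (if p = q then 2 * \<i> * of_real \<epsilon> else 0) *s \<psi>"
    and "cliff_basis None (cliff_basis (Some (Inl p)) \<psi>)
      - cliff_basis (Some (Inl p)) (cliff_basis None \<psi>)
      = of_real (2 * (\<epsilon> * \<delta>)) *s cliff_basis (Some (Inr p)) \<psi>"
    and "cliff_basis None (cliff_basis (Some (Inr p)) \<psi>)
      - cliff_basis (Some (Inr p)) (cliff_basis None \<psi>)
      = - of_real (2 * (\<epsilon> * \<delta>)) *s cliff_basis (Some (Inl p)) \<psi>"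
proof -
  let ?x = "\<lambda>p. cliff_basis (Some (Inl p))" and ?y = "\<lambda>p. cliff_basis (Some (Inr p))"
  have x: "?x q \<psi> = (of_real \<epsilon> * \<i>) *s ?y q \<psi>" for q
    using assms by (simp add: polarised_def)
  have N: "cliff_basis None \<psi> = (of_real \<delta> * \<i>) *s \<psi>"
    and e: "of_real \<epsilon> * of_real \<epsilon> = (1 :: complex)"
    using assms by (auto simp: polarised_def simp flip: of_real_mult)
  have e': "of_real \<epsilon> * (of_real \<epsilon> * z) = z" for z :: complex
    using e by (simp flip: mult.assoc)
  have xx: "?x p (?x q \<psi>) = ?y q (?y p \<psi>)"
    by (simp add: x cliff_basis_smult cliff_basis_Inl_Inr_anticommute)
      (simp add: vec_eq_iff e' mult_ac)
  show "?x p (?x q \<psi>) + ?y p (?y q \<psi>) = (if p = q then - 2 else 0) *s \<psi>"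
    unfolding xx using cliff_basis_Inr_Inr_anticommute [of p q \<psi>] by (simp add: add.commute)
  have "?x p (?y q \<psi>) - ?y p (?x q \<psi>) = - (of_real \<epsilon> * \<i>) *s (?y p (?y q \<psi>) + ?y q (?y p \<psi>))"
    by (simp add: x cliff_basis_smult cliff_basis_Inl_Inr_anticommute vec_eq_iff algebra_simps)
  then show "?x p (?y q \<psi>) - ?y p (?x q \<psi>) = (if p = q then 2 * \<i> * of_real \<epsilon> else 0) *s \<psi>"
    unfolding cliff_basis_Inr_Inr_anticommute by (auto simp: vec_eq_iff)
  show "cliff_basis None (?x p \<psi>) - ?x p (cliff_basis None \<psi>)
      = of_real (2 * (\<epsilon> * \<delta>)) *s ?y p \<psi>"
    by (simp add: cliff_basis_None_anticommute N cliff_basis_smult x)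
      (simp add: vec_eq_iff algebra_simps)
  show "cliff_basis None (?y p \<psi>) - ?y p (cliff_basis None \<psi>)
      = - of_real (2 * (\<epsilon> * \<delta>)) *s ?x p \<psi>"
    by (simp add: cliff_basis_None_anticommute N cliff_basis_smult x)
      (simp add: vec_eq_iff algebra_simps e')
qed

text \<open>
  The hypotheses on \<open>T\<close> say that it is skew between \<open>e\<^sub>1\<close> and \<open>m\<^sub>2\<close>, and that on \<open>m\<^sub>2 = \<complex>\<^sup>n\<close> it is the
  complex linear map with \<open>(q, p)\<close> entry \<open>x p q + i y p q\<close>. Only the diagonal entries of the block
  survive, because the off-diagonal combinations are anticommutators of distinct basis vectors.
\<close>

lemma spin_lift_polarised:
  fixes \<psi> :: "'n::{finite, linorder} spinor" and u w :: "'n \<Rightarrow> real" and x y :: "'n \<Rightarrow> 'n \<Rightarrow> real"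
  assumes pol: "polarised \<epsilon> \<delta> \<psi>"
    and T: "\<And>p q. g_metric a b (T (e_basis a b (Some (Inl p)))) (e_basis a b (Some (Inl q))) = x p q"
      "\<And>p q. g_metric a b (T (e_basis a b (Some (Inr p)))) (e_basis a b (Some (Inr q))) = x p q"
      "\<And>p q. g_metric a b (T (e_basis a b (Some (Inl p)))) (e_basis a b (Some (Inr q))) = y p q"
      "\<And>p q. g_metric a b (T (e_basis a b (Some (Inr p)))) (e_basis a b (Some (Inl q))) = - y p q"
      "\<And>q. g_metric a b (T (e_basis a b None)) (e_basis a b (Some (Inl q))) = u q"
      "\<And>q. g_metric a b (T (e_basis a b None)) (e_basis a b (Some (Inr q))) = w q"
      "\<And>p. g_metric a b (T (e_basis a b (Some (Inl p)))) (e_basis a b None) = - u p"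
      "\<And>p. g_metric a b (T (e_basis a b (Some (Inr p)))) (e_basis a b None) = - w p"
      "g_metric a b (T (e_basis a b None)) (e_basis a b None) = 0"
  shows "spin_lift a b T \<psi>
    = (\<i> * of_real (\<epsilon> * (\<Sum>p\<in>UNIV. y p p) / 2) - of_real ((\<Sum>p\<in>UNIV. x p p) / 2)) *s \<psi>
      + (\<epsilon> * \<delta> / 2) *\<^sub>R (\<Sum>p\<in>UNIV. u p *\<^sub>R cliff_basis (Some (Inr p)) \<psi>
          - w p *\<^sub>R cliff_basis (Some (Inl p)) \<psi>)"
proof -
  \<comment> \<open>Group the double sum into the combinations with known action on \<open>\<psi>\<close>.\<close>
  define E where "E i j = cliff_basis i (cliff_basis j \<psi>)" for i j
  note E = polarised_Clifford_products [OF pol, folded E_def]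
  have "spin_lift a b T \<psi> =
      (\<Sum>p\<in>UNIV. (u p / 4) *\<^sub>R (E None (Some (Inl p)) - E (Some (Inl p)) None)
          + (w p / 4) *\<^sub>R (E None (Some (Inr p)) - E (Some (Inr p)) None))
      + (\<Sum>p\<in>UNIV. \<Sum>q\<in>UNIV. (x p q / 4) *\<^sub>R (E (Some (Inl p)) (Some (Inl q)) + E (Some (Inr p)) (Some (Inr q)))
          + (y p q / 4) *\<^sub>R (E (Some (Inl p)) (Some (Inr q)) - E (Some (Inr p)) (Some (Inl q))))"
    unfolding spin_lift_def sum_option_Plus T E_def [symmetric]
    by (simp add: sum.distrib sum_subtractf sum_negf scaleR_right_diff_distrib scaleR_right_distrib)
  also have "\<dots> = (\<Sum>p\<in>UNIV. (u p / 4) *\<^sub>R (of_real (2 * (\<epsilon> * \<delta>)) *s cliff_basis (Some (Inr p)) \<psi>)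
          + (w p / 4) *\<^sub>R (- of_real (2 * (\<epsilon> * \<delta>)) *s cliff_basis (Some (Inl p)) \<psi>))
      + (\<Sum>p\<in>UNIV. \<Sum>q\<in>UNIV. (x p q / 4) *\<^sub>R ((if p = q then - 2 else 0) *s \<psi>)
          + (y p q / 4) *\<^sub>R ((if p = q then 2 * \<i> * of_real \<epsilon> else 0) *s \<psi>))"
    unfolding E ..
  also have "(\<Sum>p\<in>UNIV. \<Sum>q\<in>UNIV. (x p q / 4) *\<^sub>R ((if p = q then - 2 else 0) *s \<psi>)
          + (y p q / 4) *\<^sub>R ((if p = q then 2 * \<i> * of_real \<epsilon> else 0) *s \<psi>))
     = (\<Sum>p\<in>UNIV. \<Sum>q\<in>UNIV. if p = q then (\<i> * of_real (\<epsilon> * y p p / 2) - of_real (x p p / 2)) *s \<psi> else 0)"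
    by (intro sum.cong) (auto simp: vec_eq_iff scaleR_complex algebra_simps)
  also have "\<dots> = (\<i> * of_real (\<epsilon> * (\<Sum>p\<in>UNIV. y p p) / 2) - of_real ((\<Sum>p\<in>UNIV. x p p) / 2)) *s \<psi>"
    by (simp add: vec_eq_iff sum_distrib_left sum_distrib_right sum_divide_distrib sum_subtractf
        left_diff_distrib)
  also have "(\<Sum>p\<in>UNIV. (u p / 4) *\<^sub>R (of_real (2 * (\<epsilon> * \<delta>)) *s cliff_basis (Some (Inr p)) \<psi>)
          + (w p / 4) *\<^sub>R (- of_real (2 * (\<epsilon> * \<delta>)) *s cliff_basis (Some (Inl p)) \<psi>))
     = (\<epsilon> * \<delta> / 2) *\<^sub>R (\<Sum>p\<in>UNIV. u p *\<^sub>R cliff_basis (Some (Inr p)) \<psi>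
          - w p *\<^sub>R cliff_basis (Some (Inl p)) \<psi>)"
    unfolding scaleR_sum_right
    by (intro sum.cong refl) (simp add: vec_eq_iff scaleR_complex algebra_simps)
  finally show ?thesis by (simp only: add.commute)
qed

section \<open>Invariance and the generalized Killing equation\<close>

lemma g_metric_e_basis:
  fixes v :: "complex ^ 'n::finite"
  assumes "a > 0" "b > 0"
  shows "g_metric a b (m_vec t v) (e_basis a b None)
      = sqrt (a * real CARD('n) * (real CARD('n) + 1)) * t"
    and "g_metric a b (m_vec t v) (e_basis a b (Some (Inl p))) = sqrt (2 * b) * Re (v $ p)"
    and "g_metric a b (m_vec t v) (e_basis a b (Some (Inr p))) = sqrt (2 * b) * Im (v $ p)"
proof -
  define k where "k = sqrt (a * real CARD('n) * (real CARD('n) + 1))"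
  define s where "s = sqrt (2 * b)"
  have "a * real CARD('n) * (real CARD('n) + 1) > 0"
    using assms(1) by (intro mult_pos_pos) simp_all
  then have k: "k > 0" "a * (real CARD('n) * (real CARD('n) + 1)) = k * k"
    by (simp_all add: k_def mult.assoc)
  have s: "s > 0" "2 * b = s * s" using assms(2) by (simp_all add: s_def)
  show "g_metric a b (m_vec t v) (e_basis a b None)
      = sqrt (a * real CARD('n) * (real CARD('n) + 1)) * t"
    unfolding e_basis_m_vec g_metric_m_vec k_def [symmetric] k(2) using k(1) by simp
  show "g_metric a b (m_vec t v) (e_basis a b (Some (Inl p))) = sqrt (2 * b) * Re (v $ p)"
    "g_metric a b (m_vec t v) (e_basis a b (Some (Inr p))) = sqrt (2 * b) * Im (v $ p)"
    unfolding e_basis_m_vec g_metric_m_vec inner_axis inner_complex_def s_def [symmetric] s(2)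
    using s(1) by simp_all
qed

text \<open>The complex trace of the \<open>m\<^sub>2\<close>-block of \<open>ad(H)\<close> is the trace of \<open>H\<close>, which is zero.\<close>

lemma invariant_spinor_polarised:
  fixes \<psi> :: "'n::{finite, linorder} spinor"
  assumes "a > 0" "b > 0" "polarised \<epsilon> \<delta> \<psi>"
  shows "invariant_spinor a b \<psi>"
  unfolding invariant_spinor_def
proof
  fix H :: "'n cmat" assume H: "H \<in> h_alg"
  define s where "s = sqrt (2 * b)"
  have s: "s > 0" using assms(2) by (simp add: s_def)
  have "(\<Sum>p\<in>UNIV. Re (H $ Some p $ Some p)) = Re (\<Sum>p\<in>UNIV. H $ Some p $ Some p)"
    "(\<Sum>p\<in>UNIV. Im (H $ Some p $ Some p)) = Im (\<Sum>p\<in>UNIV. H $ Some p $ Some p)"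
    by simp_all
  then have tr: "(\<Sum>p\<in>UNIV. Re (H $ Some p $ Some p)) = 0" "(\<Sum>p\<in>UNIV. Im (H $ Some p $ Some p)) = 0"
    using h_algD(4) [OF H] by simp_all
  have H_axis: "(\<chi> r. \<Sum>q\<in>UNIV. H $ Some r $ Some q * axis p z $ q) = (\<chi> r. H $ Some r $ Some p * z)"
    for p z
    by (simp add: axis_def if_distrib [of "\<lambda>z. H $ _ $ _ * z"] cong: if_cong)
  have H_e: "lie_bracket H (e_basis a b None) = m_vec 0 0"
    "lie_bracket H (e_basis a b (Some (Inl p)))
      = m_vec 0 (\<chi> r. H $ Some r $ Some p * of_real (1 / s))"
    "lie_bracket H (e_basis a b (Some (Inr p)))
      = m_vec 0 (\<chi> r. H $ Some r $ Some p * (\<i> * of_real (1 / s)))" for p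
    unfolding e_basis_m_vec lie_bracket_h_alg_m_vec [OF H] H_axis s_def
    by (simp_all add: zero_vec_def flip: m_vec_zero)
  have "spin_lift a b (lie_bracket H) \<psi>
    = (\<i> * of_real (\<epsilon> * (\<Sum>p\<in>UNIV. Im (H $ Some p $ Some p)) / 2)
        - of_real ((\<Sum>p\<in>UNIV. Re (H $ Some p $ Some p)) / 2)) *s \<psi>
      + (\<epsilon> * \<delta> / 2) *\<^sub>R (\<Sum>p\<in>UNIV. 0 *\<^sub>R cliff_basis (Some (Inr p)) \<psi>
          - 0 *\<^sub>R cliff_basis (Some (Inl p)) \<psi>)"
    by (rule spin_lift_polarised [OF assms(3), where x = "\<lambda>p q. Re (H $ Some q $ Some p)"
          and y = "\<lambda>p q. Im (H $ Some q $ Some p)" and u = "\<lambda>_. 0" and w = "\<lambda>_. 0"])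
      (unfold H_e g_metric_e_basis [OF assms(1,2)] s_def [symmetric], use s in simp_all)
  then show "spin_lift a b (lie_bracket H) \<psi> = 0" by (simp add: tr)
qed

lemma clifford_m_vec:
  fixes v :: "complex ^ ('n::{finite, linorder})"
  assumes "a > 0" "b > 0"
  shows "clifford a b (m_vec t v) \<psi>
    = (sqrt (a * real CARD('n) * (real CARD('n) + 1)) * t) *\<^sub>R cliff_basis None \<psi>
      + sqrt (2 * b) *\<^sub>R (\<Sum>p\<in>UNIV. Re (v $ p) *\<^sub>R cliff_basis (Some (Inl p)) \<psi>
          + Im (v $ p) *\<^sub>R cliff_basis (Some (Inr p)) \<psi>)"
  unfolding clifford_def sum_option_Plus g_metric_e_basis [OF assms]
  by (simp add: scaleR_sum_right sum.distrib scaleR_right_distrib)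

text \<open>
  The Nomizu map in direction \<open>(t, v)\<close> acts on \<open>m\<^sub>2\<close>, up to the \<open>m\<^sub>1\<close>-component, as the
  complex scalar \<open>iKt\<close> with \<open>K = (n+1)(2b-a)/(2b)\<close>, whose trace is \<open>inKt\<close>. The remaining entries
  exchange \<open>e\<^sub>1\<close> with a multiple of \<open>iv\<close>.
\<close>

lemma nabla_polarised:
  fixes \<psi> :: "'n::{finite, linorder} spinor" and v :: "complex ^ ('n::{finite, linorder})"
  assumes ab: "a > 0" "b > 0" and pol: "polarised \<epsilon> \<delta> \<psi>"
  defines "n \<equiv> real CARD('n)"
  shows "nabla a b (m_vec t v) \<psi>
    = (\<i> * of_real (\<epsilon> * (n * (n + 1) * (2 * b - a) / (4 * b) * t))) *s \<psi>
      + (\<epsilon> * \<delta> * ((n + 1) * a / (4 * b * sqrt (a * n * (n + 1))) * sqrt (2 * b))) *\<^sub>R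
        (\<Sum>p\<in>UNIV. Re (v $ p) *\<^sub>R cliff_basis (Some (Inl p)) \<psi>
          + Im (v $ p) *\<^sub>R cliff_basis (Some (Inr p)) \<psi>)"
proof -
  define s where "s = sqrt (2 * b)"
  define k where "k = sqrt (a * n * (n + 1))"
  define K where "K = (n + 1) * (2 * b - a) / (2 * b)"
  define \<mu> where "\<mu> = (n + 1) * a / (2 * b * k)"
  have n: "n > 0" by (simp add: n_def)
  have s: "s > 0" "s * s = 2 * b" using ab by (simp_all add: s_def)
  have k: "k > 0" "k * k = a * n * (n + 1)" using ab n by (simp_all add: k_def)
  \<comment> \<open>The two entries between \<open>e\<^sub>1\<close> and \<open>m\<^sub>2\<close> are opposite, as metric compatibility demands.\<close>
  have "s * \<mu> * (n * s) = (s * s) * (a * n * (n + 1)) / (2 * b * k)"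
    by (simp add: \<mu>_def)
  also have "\<dots> = k" unfolding s(2) k(2) [symmetric] using ab k(1) by simp
  finally have ks: "k * z / (n * s) = s * (\<mu> * z)" for z
    using n s(1) by (simp add: field_simps)
  have i_axis: "(\<i> *s v) \<bullet> axis p z = - Im (v $ p) * Re z + Re (v $ p) * Im z"
    "\<i> *s axis p z = axis p (\<i> * z)" for p z
    by (simp_all add: inner_axis inner_complex_def) (simp add: vec_eq_iff axis_def)
  have T: "Nomizu a b (m_vec t v) (e_basis a b None) = m_vec 0 (- \<mu> *\<^sub>R (\<i> *s v))"
    "Nomizu a b (m_vec t v) (e_basis a b (Some (Inl p)))
      = m_vec (- Im (v $ p) / (n * s)) ((K * t / s) *\<^sub>R axis p \<i>)"
    "Nomizu a b (m_vec t v) (e_basis a b (Some (Inr p)))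
      = m_vec (Re (v $ p) / (n * s)) ((K * t / s) *\<^sub>R axis p (- 1))" for p
    unfolding e_basis_m_vec Nomizu_m_vec [OF ab] i_axis n_def [symmetric] k_def [symmetric]
      s_def [symmetric] K_def [symmetric] \<mu>_def m_vec_eq_iff
    by (simp_all add: vec_eq_iff axis_def scaleR_complex mult_ac)
  have "nabla a b (m_vec t v) \<psi>
    = (\<i> * of_real (\<epsilon> * (\<Sum>p\<in>(UNIV :: 'n set). K * t * (if p = p then 1 else 0)) / 2)
        - of_real ((\<Sum>p\<in>(UNIV :: 'n set). 0) / 2)) *s \<psi>
      + (\<epsilon> * \<delta> / 2) *\<^sub>R (\<Sum>p\<in>UNIV. (s * \<mu> * Im (v $ p)) *\<^sub>R cliff_basis (Some (Inr p)) \<psi>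
          - (- (s * \<mu> * Re (v $ p))) *\<^sub>R cliff_basis (Some (Inl p)) \<psi>)"
    unfolding nabla_def
    by (rule spin_lift_polarised [OF pol, where x = "\<lambda>_ _. 0"
          and y = "\<lambda>p q. K * t * (if p = q then 1 else 0)"
          and u = "\<lambda>p. s * \<mu> * Im (v $ p)" and w = "\<lambda>p. - (s * \<mu> * Re (v $ p))"])
      (unfold T g_metric_e_basis [OF ab] n_def [symmetric] k_def [symmetric] s_def [symmetric],
        use s in \<open>simp_all add: axis_def ks\<close>)
  also have "\<dots> = (\<i> * of_real (\<epsilon> * (n * K / 2 * t))) *s \<psi>
      + (\<epsilon> * \<delta> * (\<mu> / 2 * s)) *\<^sub>R
        (\<Sum>p\<in>UNIV. Re (v $ p) *\<^sub>R cliff_basis (Some (Inl p)) \<psi>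
          + Im (v $ p) *\<^sub>R cliff_basis (Some (Inr p)) \<psi>)"
    by (simp add: n_def scaleR_sum_right scaleR_right_distrib algebra_simps)
  finally show ?thesis
    unfolding K_def \<mu>_def by (simp add: s_def k_def mult.assoc)
qed

text \<open>
  The factor \<open>sqrt (a * n * (n + 1))\<close> is the \<open>e\<^sub>1\<close>-coordinate of \<open>(1, 0)\<close>.
\<close>

lemma Killing_constants:
  fixes a b n :: real
  assumes "a > 0" "b > 0" "n > 0"
  shows "sqrt (a * n * (n + 1)) * ((2 * b - a) * sqrt (n * (n + 1)) / (4 * b * sqrt a))
      = n * (n + 1) * (2 * b - a) / (4 * b)"
    and "sqrt (a * (n + 1)) / (4 * b * sqrt n) = (n + 1) * a / (4 * b * sqrt (a * n * (n + 1)))"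
proof -
  define x y z where "x = sqrt a" and "y = sqrt n" and "z = sqrt (n + 1)"
  have pos: "x > 0" "y > 0" "z > 0" using assms by (simp_all add: x_def y_def z_def)
  have a: "a = x * x" and n: "n = y * y" and n1: "n + 1 = z * z"
    using assms by (simp_all add: x_def y_def z_def)
  have root: "sqrt (a * n * (n + 1)) = x * y * z" "sqrt (n * (n + 1)) = y * z"
    "sqrt (a * (n + 1)) = x * z"
    by (simp_all add: real_sqrt_mult x_def y_def z_def)
  show "sqrt (a * n * (n + 1)) * ((2 * b - a) * sqrt (n * (n + 1)) / (4 * b * sqrt a))
      = n * (n + 1) * (2 * b - a) / (4 * b)"
    unfolding root x_def [symmetric] unfolding n1 using pos assms(2) by (simp add: n field_simps)
  show "sqrt (a * (n + 1)) / (4 * b * sqrt n) = (n + 1) * a / (4 * b * sqrt (a * n * (n + 1)))"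
    unfolding root y_def [symmetric] unfolding n1 using pos assms(2) by (simp add: a field_simps)
qed

lemma symmetric_endomorphism_block_scalar:
  "symmetric_endomorphism a b (\<lambda>X. \<sigma> *\<^sub>R (l *\<^sub>R proj m1_space X + m *\<^sub>R proj m2_space X))"
  unfolding symmetric_endomorphism_def
  by (auto simp: m_space_eq m_vec_add m_vec_scaleR proj_m_vec g_metric_m_vec algebra_simps image_iff)

text \<open>
  Comparing the two sides, the equality \<open>\<delta>\<^sup>2 = 1\<close> turns \<open>\<epsilon> i \<psi>\<close> into \<open>\<epsilon>\<delta> e\<^sub>1 \<cdot> \<psi>\<close>, so that the same sign
  \<open>\<epsilon>\<delta>\<close> appears on \<open>m\<^sub>1\<close> and on \<open>m\<^sub>2\<close>.
\<close>

lemma generalized_Killing_spinor_polarised: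
  fixes \<psi> :: "'n::{finite, linorder} spinor" and a b n :: real
  assumes ab: "a > 0" "b > 0" and pol: "polarised \<epsilon> \<delta> \<psi>" and n: "n = real CARD('n)"
    and l1: "lambda1 = (2 * b - a) * sqrt (n * (n + 1)) / (4 * b * sqrt a)"
    and l2: "lambda2 = sqrt (a * (n + 1)) / (4 * b * sqrt n)"
  shows "generalized_Killing_spinor a b
    (\<lambda>X. (\<epsilon> * \<delta>) *\<^sub>R (lambda1 *\<^sub>R proj m1_space X + lambda2 *\<^sub>R proj m2_space X)) \<psi>"
  unfolding generalized_Killing_spinor_def
proof (intro conjI ballI)
  fix X :: "'n cmat" assume "X \<in> m_space"
  then obtain t v where X: "X = m_vec t v" by (rule m_spaceE)
  have "n > 0" by (simp add: n)
  note const = Killing_constants [OF ab this, folded l1 l2]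
  have N: "cliff_basis None \<psi> = (of_real \<delta> * \<i>) *s \<psi>" and d: "\<delta> * \<delta> = 1"
    using pol by (auto simp: polarised_def)
  have "clifford a b ((\<epsilon> * \<delta>) *\<^sub>R (lambda1 *\<^sub>R proj m1_space X + lambda2 *\<^sub>R proj m2_space X)) \<psi>
    = clifford a b (m_vec (\<epsilon> * \<delta> * lambda1 * t) ((\<epsilon> * \<delta> * lambda2) *\<^sub>R v)) \<psi>"
    by (simp add: X proj_m_vec m_vec_scaleR m_vec_add mult.assoc)
  also have "\<dots> = (\<epsilon> * \<delta> * (sqrt (a * n * (n + 1)) * lambda1) * t) *\<^sub>R ((of_real \<delta> * \<i>) *s \<psi>)
      + (\<epsilon> * \<delta> * (lambda2 * sqrt (2 * b))) *\<^sub>R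
        (\<Sum>p\<in>UNIV. Re (v $ p) *\<^sub>R cliff_basis (Some (Inl p)) \<psi>
          + Im (v $ p) *\<^sub>R cliff_basis (Some (Inr p)) \<psi>)"
    unfolding clifford_m_vec [OF ab] n [symmetric] N
    by (simp add: scaleR_sum_right scaleR_right_distrib mult_ac)
  also have "(\<epsilon> * \<delta> * (sqrt (a * n * (n + 1)) * lambda1) * t) *\<^sub>R ((of_real \<delta> * \<i>) *s \<psi>)
      = (\<i> * of_real (\<epsilon> * (sqrt (a * n * (n + 1)) * lambda1 * t) * (\<delta> * \<delta>))) *s \<psi>"
    by (simp add: vec_eq_iff scaleR_complex mult_ac)
  also have "\<dots> = (\<i> * of_real (\<epsilon> * (sqrt (a * n * (n + 1)) * lambda1 * t))) *s \<psi>"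
    by (simp only: d mult_1_right)
  finally show "nabla a b X \<psi>
      = clifford a b ((\<epsilon> * \<delta>) *\<^sub>R (lambda1 *\<^sub>R proj m1_space X + lambda2 *\<^sub>R proj m2_space X)) \<psi>"
    unfolding X nabla_polarised [OF ab pol] n [symmetric] const by simp
qed (rule symmetric_endomorphism_block_scalar)

theorem theorem3p13:
  fixes a b n lambda1 lambda2 :: real
    and A_plus A_minus :: "'n::{finite, linorder} cmat \<Rightarrow> 'n cmat"
  assumes "a > 0" and "b > 0"
    and "n = real CARD('n)"
    and "lambda1 = (2 * b - a) * sqrt (n * (n + 1)) / (4 * b * sqrt a)"
    and "lambda2 = sqrt (a * (n + 1)) / (4 * b * sqrt n)"
    and "A_plus = (\<lambda>X. lambda1 *\<^sub>R proj m1_space X + lambda2 *\<^sub>R proj m2_space X)"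
    and "A_minus = (\<lambda>X. (-1) ^ (CARD('n) + 1) *\<^sub>R A_plus X)"
  shows "invariant_spinor a b (psi_plus :: 'n spinor) \<and>
         invariant_spinor a b (psi_minus :: 'n spinor) \<and>
         generalized_Killing_spinor a b A_plus psi_plus \<and>
         generalized_Killing_spinor a b A_minus psi_minus"
proof (intro conjI)
  show "invariant_spinor a b (psi_plus :: 'n spinor)"
    by (rule invariant_spinor_polarised [OF assms(1,2) polarised_psi_plus])
  show "invariant_spinor a b (psi_minus :: 'n spinor)"
    by (rule invariant_spinor_polarised [OF assms(1,2) polarised_psi_minus])
  show "generalized_Killing_spinor a b A_plus psi_plus"
    using generalized_Killing_spinor_polarised [OF assms(1,2) polarised_psi_plus assms(3-5)]
    by (simp add: assms(6))
  show "generalized_Killing_spinor a b A_minus psi_minus"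
    using generalized_Killing_spinor_polarised [OF assms(1,2) polarised_psi_minus assms(3-5)]
    by (simp add: assms(6,7))
qed

end
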